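(* Let $\alpha\in\mathbb R$ and $\phi_\alpha(x,y)=(xy)^\alpha$. For every $n\ge 3$, deletion of one edge $e$ from the complete graph $K_n$ has the following effect on both the weighted spectral radius $\rho(\dot A(\cdot))$ and the weighted energy $\dot E_{\phi_\alpha}(\cdot)$ (comparing the values for $K_n-e$ with those for $K_n$): (1) they both increase if $\alpha<-\tfrac12$; (2) they both remain unchanged if $\alpha=-\tfrac12$; (3) they both decrease if $\alpha>-\tfrac12$.
   Context: For a symmetric function $\phi$ and a finite simple graph $G$ with vertices $v_1,\dots,v_n$ of degrees $d_1,\dots,d_n$, the degree-based weighted adjacency matrix $\dot A(G)$ is the $n\times n$ real symmetric matrix whose $(i,j)$ entry is $\phi(d_i,d_j)$ if $v_i$ and $v_j$ are adjacent, and $0$ otherwise; here $\phi=\phi_\alpha$. $\rho(M)$ is the spectral radius, and the weighted energy $\dot E_\phi(G)$ is the sum of the absolute values of the eigenvalues of $\dot A(G)$. $G-e$ is obtained by deleting the edge $e$ (keeping all vertices); $\dot A(G-e)$ is computed with the degrees of $G-e$. "Increase" and "decrease" are strict. *)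

theory Defs
  imports Complex_Main "Jordan_Normal_Form.Spectral_Radius"
begin

text \<open>
  A finite simple graph with enumerated vertices $v_1, \dots, v_n$ is given by the number \<open>n\<close> of its
  vertices, which are \<open>0, \<dots>, n - 1\<close>, and its set \<open>E\<close> of edges, which are two-element vertex sets.
\<close>

definition simple_graph :: "nat \<Rightarrow> nat set set \<Rightarrow> bool" where
  "simple_graph n E \<longleftrightarrow> (\<forall>e\<in>E. e \<subseteq> {..<n} \<and> card e = 2)"

definition complete_edges :: "nat \<Rightarrow> nat set set" where
  "complete_edges n = {e. e \<subseteq> {..<n} \<and> card e = 2}"

definition degree_of :: "nat set set \<Rightarrow> nat \<Rightarrow> nat" where
  "degree_of E v = card {e \<in> E. v \<in> e}"

definition delete_edge :: "nat set set \<Rightarrow> nat set \<Rightarrow> nat set set" where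
  "delete_edge E e = E - {e}"

definition weighted_adjacency :: "(real \<Rightarrow> real \<Rightarrow> real) \<Rightarrow> nat \<Rightarrow> nat set set \<Rightarrow> real mat" where
  "weighted_adjacency \<phi> n E =
     mat n n (\<lambda>(i, j). if {i, j} \<in> E then \<phi> (real (degree_of E i)) (real (degree_of E j)) else 0)"

text \<open>
  Spectral notions of a real matrix are those of its complexification; \<open>spectral_radius\<close> is defined
  for complex matrices only.
\<close>

abbreviation complexify :: "real mat \<Rightarrow> complex mat" where
  "complexify \<equiv> map_mat complex_of_real"

definition weighted_spectral_radius :: "(real \<Rightarrow> real \<Rightarrow> real) \<Rightarrow> nat \<Rightarrow> nat set set \<Rightarrow> real" where
  "weighted_spectral_radius \<phi> n E = spectral_radius (complexify (weighted_adjacency \<phi> n E))"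

text \<open>
  The set \<open>spectrum A\<close> forgets multiplicities, so each eigenvalue is weighted by its multiplicity as a
  root of the characteristic polynomial.
\<close>

definition matrix_energy :: "complex mat \<Rightarrow> real" where
  "matrix_energy A = (\<Sum>x\<in>spectrum A. real (order x (char_poly A)) * cmod x)"

definition weighted_energy :: "(real \<Rightarrow> real \<Rightarrow> real) \<Rightarrow> nat \<Rightarrow> nat set set \<Rightarrow> real" where
  "weighted_energy \<phi> n E = matrix_energy (complexify (weighted_adjacency \<phi> n E))"

definition phi :: "real \<Rightarrow> real \<Rightarrow> real \<Rightarrow> real" where
  "phi \<alpha> x y = (x * y) powr \<alpha>"

lemma phi_commute: "phi \<alpha> x y = phi \<alpha> y x"
  by (simp add: phi_def mult.commute)

lemma simple_graph_complete_edges: "simple_graph n (complete_edges n)"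
  by (simp add: simple_graph_def complete_edges_def)

lemma simple_graph_delete_edge: "simple_graph n E \<Longrightarrow> simple_graph n (delete_edge E e)"
  by (simp add: simple_graph_def delete_edge_def)

end

theory Submission
  imports Defs
begin

text \<open>
  Let $e = \{u, v\}$. The weighted matrices of $K_n$ and of $K_n - e$ have the same shape: the diagonal
  is zero, and an off-diagonal entry depends only on how many of its two indices lie in \<open>e\<close>. In
  \<open>two_block_mat n T s t r\<close> the entry is \<open>r\<close> inside \<open>T\<close>, \<open>s\<close> outside \<open>T\<close> and \<open>t\<close> between the two.
  For such a matrix $A$, $x - A$ is a diagonal matrix minus a product of an $n \times 2$ and a
  $2 \times n$ matrix, so Sylvester's identity $\det(1 - UV) = \det(1 - VU)$ reduces its characteristic polynomial
  to a $2 \times 2$ determinant (\<open>char_poly_two_block_mat\<close>): with $P = n - |T|$ and $Q = |T|$ it is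
  $$(x + s)^{P-1} (x + r)^{Q-1} \bigl((x - (P-1)s)(x - (Q-1)r) - P Q t^2\bigr).$$

  In both of our cases the eigenvalues are one number $\rho \ge 0$ and otherwise numbers $\le 0$. As
  the trace vanishes, the negative ones have absolute values adding up to $\rho$. Hence the spectral
  radius is $\rho$ and the energy is $2 \rho$
  (\<open>spectral_radius_energy_of_single_positive_eigenvalue\<close>), and it suffices to compare the two values
  of $\rho$, which are the nonnegative roots of quadratics.

  Put $M = n - 1$, $m = n - 2$ and $a = M^{2\alpha}$, and let $c = (n-3)a$. For $K_n$ the value is
  $R = Ma$, and it satisfies $R (R - c) = 2 a M^{2\alpha+1}$. For $K_n - e$ the weight between \<open>e\<close> and
  the other vertices is $b = (Mm)^\alpha$, and the quadratic reads
  $\rho (\rho - c) = 2 m b^2 = 2 a m^{2\alpha+1}$. Since $y \mapsto y (y - c)$ increases for $y \ge c$,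
  the order of $\rho$ and $R$ is that of $m^{2\alpha+1}$ and $M^{2\alpha+1}$, which is decided by the
  sign of $2\alpha + 1$.
\<close>

section \<open>Two determinant identities\<close>

text \<open>
  Both sides are the determinant of the block matrix with blocks $1, V, U, 1$: clearing the lower left
  block by row operations gives the left-hand side, clearing it by column operations gives the
  right-hand side.
\<close>

lemma det_one_minus_mult_commute:
  fixes U V :: "'a :: idom mat"
  assumes U: "U \<in> carrier_mat n k" and V: "V \<in> carrier_mat k n"
  shows "det (1\<^sub>m n - U * V) = det (1\<^sub>m k - V * U)"
proof -
  let ?M = "four_block_mat (1\<^sub>m k) V U (1\<^sub>m n)"
  have "four_block_mat (1\<^sub>m k) (0\<^sub>m k n) U (1\<^sub>m n) * four_block_mat (1\<^sub>m k) V (0\<^sub>m n k) (1\<^sub>m n - U * V) =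
    four_block_mat (1\<^sub>m k * 1\<^sub>m k + 0\<^sub>m k n * 0\<^sub>m n k) (1\<^sub>m k * V + 0\<^sub>m k n * (1\<^sub>m n - U * V))
      (U * 1\<^sub>m k + 1\<^sub>m n * 0\<^sub>m n k) (U * V + 1\<^sub>m n * (1\<^sub>m n - U * V))"
    by (rule mult_four_block_mat) (use U V in auto)
  also have "\<dots> = ?M"
    using U V by (intro cong_four_block_mat) auto
  finally have left: "?M = four_block_mat (1\<^sub>m k) (0\<^sub>m k n) U (1\<^sub>m n) *
      four_block_mat (1\<^sub>m k) V (0\<^sub>m n k) (1\<^sub>m n - U * V)" ..
  have "det ?M = det (four_block_mat (1\<^sub>m k) (0\<^sub>m k n) U (1\<^sub>m n)) *
      det (four_block_mat (1\<^sub>m k) V (0\<^sub>m n k) (1\<^sub>m n - U * V))"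
    unfolding left by (rule det_mult[of _ "k + n"]) (use U V in auto)
  also have "\<dots> = det (1\<^sub>m n - U * V)"
    using U V by (subst det_four_block_mat_upper_right_zero[of _ k _ n], auto)
      (subst det_four_block_mat_lower_left_zero[of _ k _ n], auto)
  finally have one: "det ?M = det (1\<^sub>m n - U * V)" .
  have "?M * four_block_mat (1\<^sub>m k) (0\<^sub>m k n) (- U) (1\<^sub>m n) =
    four_block_mat (1\<^sub>m k * 1\<^sub>m k + V * (- U)) (1\<^sub>m k * 0\<^sub>m k n + V * 1\<^sub>m n)
      (U * 1\<^sub>m k + 1\<^sub>m n * (- U)) (U * 0\<^sub>m k n + 1\<^sub>m n * 1\<^sub>m n)"
    by (rule mult_four_block_mat) (use U V in auto)
  also have "\<dots> = four_block_mat (1\<^sub>m k - V * U) V (0\<^sub>m n k) (1\<^sub>m n)"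
    using U V by (intro cong_four_block_mat) (auto intro!: eq_matI)
  finally have right: "?M * four_block_mat (1\<^sub>m k) (0\<^sub>m k n) (- U) (1\<^sub>m n) =
    four_block_mat (1\<^sub>m k - V * U) V (0\<^sub>m n k) (1\<^sub>m n)" .
  have "det ?M * det (four_block_mat (1\<^sub>m k) (0\<^sub>m k n) (- U) (1\<^sub>m n)) =
      det (four_block_mat (1\<^sub>m k - V * U) V (0\<^sub>m n k) (1\<^sub>m n))"
    unfolding right[symmetric] by (rule det_mult[symmetric, of _ "k + n"]) (use U V in auto)
  moreover have "det (four_block_mat (1\<^sub>m k) (0\<^sub>m k n) (- U) (1\<^sub>m n)) = 1"
    using U by (subst det_four_block_mat_upper_right_zero[of _ k _ n]) auto
  moreover have "det (four_block_mat (1\<^sub>m k - V * U) V (0\<^sub>m n k) (1\<^sub>m n)) = det (1\<^sub>m k - V * U)"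
    using U V by (subst det_four_block_mat_lower_left_zero[of _ k _ n]) auto
  ultimately show ?thesis using one by simp
qed

lemma det_mat_2_2:
  fixes A :: "'a :: idom mat"
  assumes A: "A \<in> carrier_mat 2 2"
  shows "det A = A $$ (0,0) * A $$ (1,1) - A $$ (0,1) * A $$ (1,0)"
proof -
  have "A = four_block_mat (mat 1 1 (\<lambda>_. A $$ (0,0))) (mat 1 1 (\<lambda>_. A $$ (0,1)))
      (mat 1 1 (\<lambda>_. A $$ (1,0))) (mat 1 1 (\<lambda>_. A $$ (1,1)))" (is "A = four_block_mat ?a ?b ?c ?d")
    by (rule eq_matI) (use A in \<open>auto simp: numeral_2_eq_2 less_Suc_eq\<close>)
  from arg_cong[OF this, of det] have "det A = det (four_block_mat ?a ?b ?c ?d)" .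
  also have "\<dots> = det (?a * ?d - ?b * ?c)"
  proof (rule det_four_block_mat[of _ 1])
    show "?c * ?d = ?d * ?c"
      by (rule eq_matI) (auto simp: scalar_prod_def mult.commute)
  qed auto
  also have "\<dots> = A $$ (0,0) * A $$ (1,1) - A $$ (0,1) * A $$ (1,0)"
    by (subst det_single) (auto simp: scalar_prod_def)
  finally show ?thesis .
qed

section \<open>The characteristic polynomial of a two-block matrix\<close>

definition two_block_mat :: "nat \<Rightarrow> nat set \<Rightarrow> real \<Rightarrow> real \<Rightarrow> real \<Rightarrow> real mat" where
  "two_block_mat n T s t r = mat n n (\<lambda>(i, j).
     if i = j then 0 else if i \<in> T then (if j \<in> T then r else t) else (if j \<in> T then t else s))"

text \<open>
  The hypotheses on \<open>x\<close> make the diagonal part \<open>D\<close> of $x - A$ invertible, so that $x - A$ can be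
  written as $D (1 - WV)$ with \<open>W\<close> having two columns.
\<close>

lemma poly_char_poly_two_block_mat:
  fixes s t r x :: real
  assumes T: "T \<subseteq> {..<n}" and q: "card T = Suc q" and n: "n = Suc p + Suc q"
    and xs: "x \<noteq> - s" and xr: "x \<noteq> - r"
  shows "poly (char_poly (two_block_mat n T s t r)) x =
    (x + s) ^ p * (x + r) ^ q * ((x - real p * s) * (x - real q * r) - real (Suc p) * real (Suc q) * t\<^sup>2)"
proof -
  \<comment> \<open>Row \<open>c\<close> of \<open>V\<close> lists the entries of the matrix seen from the block with number \<open>c\<close>, where \<open>T\<close> has
    number 1. On the diagonal this pattern has \<open>s\<close> or \<open>r\<close> where the matrix has 0, which \<open>d\<close> corrects;
    the factor \<open>1 / d i\<close> in \<open>W\<close> compensates for pulling out \<open>D\<close>.\<close>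
  define d where "d i = (if i \<in> T then x + r else x + s)" for i
  define D where "D = mat n n (\<lambda>(i, j). if i = j then d i else 0)"
  define W where "W = mat n 2 (\<lambda>(i, c). if (i \<in> T) = (c = 1) then 1 / d i else 0)"
  define V where "V = mat 2 n (\<lambda>(c, j). if c = 1 then (if j \<in> T then r else t) else (if j \<in> T then t else s))"
  have d0: "d i \<noteq> 0" for i using xs xr by (auto simp: d_def)
  have cD: "D \<in> carrier_mat n n" and cW: "W \<in> carrier_mat n 2" and cV: "V \<in> carrier_mat 2 n"
    by (auto simp: D_def W_def V_def)
  have cS: "card ({..<n} - T) = Suc p"
    using T q n by (auto simp: finite_subset card_Diff_subset)
  have split: "(\<Sum>i = 0..<n. if i \<in> T then f else g) = Suc q * f + Suc p * g" for f g :: real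
  proof -
    have "(\<Sum>i = 0..<n. if i \<in> T then f else g) =
        (\<Sum>i \<in> T. f) + (\<Sum>i \<in> {..<n} - T. g)"
      using T by (subst sum.If_cases) (simp_all add: lessThan_atLeast0 Int_absorb1 Diff_eq)
    then show ?thesis using q cS by simp
  qed
  have "- char_matrix (two_block_mat n T s t r) x = D * (1\<^sub>m n - W * V)"
  proof (rule eq_matI, goal_cases)
    case (1 i j)
    then have ij: "i < n" "j < n" using cD cW cV by auto
    have "(D * (1\<^sub>m n - W * V)) $$ (i, j) = (\<Sum>k = 0..<n. D $$ (i, k) * (1\<^sub>m n - W * V) $$ (k, j))"
      using ij cD cW cV by (simp add: scalar_prod_def)
    also have "\<dots> = (\<Sum>k = 0..<n. if k = i then d i * (1\<^sub>m n - W * V) $$ (i, j) else 0)"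
      by (rule sum.cong) (use ij in \<open>auto simp: D_def\<close>)
    also have "\<dots> = d i * (1\<^sub>m n - W * V) $$ (i, j)"
      using ij by simp
    also have "(1\<^sub>m n - W * V) $$ (i, j) = (if i = j then 1 else 0) - (W $$ (i,0) * V $$ (0,j) + W $$ (i,1) * V $$ (1,j))"
      using ij cW cV by (simp add: scalar_prod_def numeral_2_eq_2)
    also have "d i * \<dots> = (if i = j then d i else 0)
        - (if i \<in> T then (if j \<in> T then r else t) else (if j \<in> T then t else s))"
      using ij d0[of i] by (simp add: W_def V_def right_diff_distrib)
    also have "\<dots> = (- char_matrix (two_block_mat n T s t r) x) $$ (i, j)"
      using ij by (auto simp: char_matrix_def two_block_mat_def d_def)
    finally show ?case by simp
  qed (use cD cW cV in \<open>auto simp: two_block_mat_def char_matrix_def\<close>)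
  then have "poly (char_poly (two_block_mat n T s t r)) x = det (D * (1\<^sub>m n - W * V))"
    by (subst char_poly_matrix[of _ n]) (auto simp: two_block_mat_def)
  also have "\<dots> = det D * det (1\<^sub>m 2 - V * W)"
    using cD cW cV det_mult[of D n "1\<^sub>m n - W * V"] det_one_minus_mult_commute[OF cW cV]
    by (simp add: minus_carrier_mat)
  also have "det D = (\<Prod>i = 0..<n. d i)"
    by (subst det_upper_triangular[of _ n]) (auto simp: D_def prod_list_diag_prod upper_triangular_def)
  also have "\<dots> = (\<Prod>i \<in> T. x + r) * (\<Prod>i \<in> {..<n} - T. x + s)"
    unfolding d_def using T
    by (subst prod.If_cases) (simp_all add: lessThan_atLeast0 Int_absorb1 Diff_eq)
  also have "\<dots> = (x + r) ^ Suc q * (x + s) ^ Suc p"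
    using q cS by simp
  also have "det (1\<^sub>m 2 - V * W) = (1 - Suc p * (s / (x + s))) * (1 - Suc q * (r / (x + r)))
      - (Suc q * (t / (x + r))) * (Suc p * (t / (x + s)))"
  proof -
    have "(V * W) $$ (0, 0) = (\<Sum>i = 0..<n. if i \<in> T then 0 else s / (x + s))"
      by (auto simp: scalar_prod_def V_def W_def d_def intro!: sum.cong)
    moreover have "(V * W) $$ (0, 1) = (\<Sum>i = 0..<n. if i \<in> T then t / (x + r) else 0)"
      by (auto simp: scalar_prod_def V_def W_def d_def intro!: sum.cong)
    moreover have "(V * W) $$ (1, 0) = (\<Sum>i = 0..<n. if i \<in> T then 0 else t / (x + s))"
      by (auto simp: scalar_prod_def V_def W_def d_def intro!: sum.cong)
    moreover have "(V * W) $$ (1, 1) = (\<Sum>i = 0..<n. if i \<in> T then r / (x + r) else 0)"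
      by (auto simp: scalar_prod_def V_def W_def d_def intro!: sum.cong)
    ultimately show ?thesis
      using cV cW unfolding split by (subst det_mat_2_2) auto
  qed
  also have "(x + r) ^ Suc q * (x + s) ^ Suc p * \<dots> = (x + s) ^ p * (x + r) ^ q *
      ((x + s) * (x + r) * \<dots>)"
    by (simp only: power_Suc mult_ac)
  also have "(x + s) * (x + r) * ((1 - Suc p * (s / (x + s))) * (1 - Suc q * (r / (x + r)))
        - (Suc q * (t / (x + r))) * (Suc p * (t / (x + s)))) =
      ((x + s) * (1 - Suc p * (s / (x + s)))) * ((x + r) * (1 - Suc q * (r / (x + r))))
        - real (Suc p) * real (Suc q) * ((x + s) * (t / (x + s))) * ((x + r) * (t / (x + r)))"
  proof -
    have "u * v * ((1 - a * b) * (1 - c * d) - (c * e) * (a * f)) =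
        (u * (1 - a * b)) * (v * (1 - c * d)) - a * c * (u * f) * (v * e)"
      for u v a b c d e f :: real
      by (simp add: algebra_simps)
    then show ?thesis .
  qed
  also have "(x + s) * (1 - Suc p * (s / (x + s))) = x - real p * s"
    using xs by (simp add: right_diff_distrib) (simp add: algebra_simps)
  also have "(x + r) * (1 - Suc q * (r / (x + r))) = x - real q * r"
    using xr by (simp add: right_diff_distrib) (simp add: algebra_simps)
  also have "real (Suc p) * real (Suc q) * ((x + s) * (t / (x + s))) * ((x + r) * (t / (x + r))) =
      real (Suc p) * real (Suc q) * t\<^sup>2"
    using xs xr by (simp add: power2_eq_square)
  finally show ?thesis .
qed

text \<open>
  Two polynomials that agree away from $-s$ and $-r$ are equal, so the restriction on the argument
  disappears.
\<close>

lemma char_poly_two_block_mat: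
  fixes s t r :: real
  assumes T: "T \<subseteq> {..<n}" and q: "card T = Suc q" and n: "n = Suc p + Suc q"
  shows "char_poly (two_block_mat n T s t r) =
    [:s, 1:] ^ p * [:r, 1:] ^ q * ([:- (real p * s), 1:] * [:- (real q * r), 1:] - [:real (Suc p) * real (Suc q) * t\<^sup>2:])"
    (is "?l = ?r")
proof (rule ccontr)
  assume "?l \<noteq> ?r"
  then have "finite {x. poly (?l - ?r) x = 0}"
    by (intro poly_roots_finite) simp
  then have "finite ({x. poly (?l - ?r) x = 0} \<union> {- s, - r})" by simp
  moreover have "{x. poly (?l - ?r) x = 0} \<union> {- s, - r} = UNIV"
    using poly_char_poly_two_block_mat[OF assms]
    by (auto simp del: mult_pCons_left mult_pCons_right of_nat_Suc simp: add.commute)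
  ultimately show False using infinite_UNIV_char_0[where 'a = real] by metis
qed

section \<open>Spectral radius and energy from a factorization\<close>

lemma order_prod_linear:
  "order x (\<Prod>a\<leftarrow>as. [:- a, 1:]) = count_list as (x :: 'a :: field)"
proof (induction as)
  case (Cons a as)
  have "order x ([:- a, 1:] * (\<Prod>a\<leftarrow>as. [:- a, 1:])) =
      order x [:- a, 1:] + order x (\<Prod>a\<leftarrow>as. [:- a, 1:])"
    by (rule order_mult) (auto simp del: mult_pCons_left)
  then show ?case using Cons by (auto simp: order_linear' simp del: mult_pCons_left)
qed simp

lemma spectrum_of_linear_factors:
  fixes A :: "'a :: field mat"
  assumes "A \<in> carrier_mat n n" and "char_poly A = (\<Prod>a\<leftarrow>as. [:- a, 1:])"
  shows "spectrum A = set as"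
  using assms by (auto simp: spectrum_root_char_poly poly_prod_list)

lemma sum_count_list:
  fixes f :: "'a \<Rightarrow> real"
  assumes "finite X" and "set xs \<subseteq> X"
  shows "(\<Sum>x\<leftarrow>xs. f x) = (\<Sum>x\<in>X. real (count_list xs x) * f x)"
  using assms(2)
proof (induction xs)
  case (Cons y ys)
  have "(\<Sum>x\<in>X. real (count_list (y # ys) x) * f x) =
      (\<Sum>x\<in>X. real (count_list ys x) * f x + (if y = x then f x else 0))"
    by (rule sum.cong) (auto simp: algebra_simps)
  then show ?case using Cons assms(1) by (simp add: sum.distrib)
qed simp

lemma matrix_energy_of_linear_factors:
  assumes "A \<in> carrier_mat n n" and "char_poly A = (\<Prod>a\<leftarrow>as. [:- a, 1:])"
  shows "matrix_energy A = (\<Sum>a\<leftarrow>as. cmod a)"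
  unfolding matrix_energy_def spectrum_of_linear_factors[OF assms] assms(2) order_prod_linear

  by (rule sum_count_list[symmetric]) auto

lemma char_poly_complexify_of_linear_factors:
  assumes "A \<in> carrier_mat n n" and "char_poly A = (\<Prod>a\<leftarrow>as. [:- a, 1:])"
  shows "char_poly (complexify A) = (\<Prod>a\<leftarrow>map complex_of_real as. [:- a, 1:])"
proof -
  interpret map_poly_comm_ring_hom complex_of_real ..
  have "map_poly complex_of_real (\<Prod>a\<leftarrow>as. [:- a, 1:]) = (\<Prod>a\<leftarrow>map complex_of_real as. [:- a, 1:])"
    by (induction as) (auto simp: hom_mult simp del: mult_pCons_left)
  then show ?thesis
    using assms by (simp add: of_real_hom.char_poly_hom)
qed

text \<open>
  The condition on \<open>sum_list cs\<close> says that the trace is zero. It yields both claims: the eigenvalues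
  \<open>- c\<close> have absolute values with sum \<open>\<rho>\<close>, so none of them exceeds \<open>\<rho>\<close>, and together with \<open>\<rho>\<close>
  itself they contribute \<open>\<rho> + \<rho>\<close> to the energy.
\<close>

lemma spectral_radius_energy_of_single_positive_eigenvalue:
  fixes \<rho> :: real
  assumes A: "A \<in> carrier_mat n n"
    and cp: "char_poly A = [:- \<rho>, 1:] * (\<Prod>c\<leftarrow>cs. [:c, 1:])"
    and nonneg: "\<forall>c\<in>set cs. 0 \<le> c" and trace: "sum_list cs = \<rho>"
  shows "spectral_radius (complexify A) = \<rho>" and "matrix_energy (complexify A) = 2 * \<rho>"
proof -
  define as where "as = map complex_of_real (\<rho> # map uminus cs)"
  have cA: "complexify A \<in> carrier_mat n n" using A by simp
  have cp': "char_poly (complexify A) = (\<Prod>a\<leftarrow>as. [:- a, 1:])"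
    unfolding as_def using A cp
    by (intro char_poly_complexify_of_linear_factors) (simp_all add: o_def del: mult_pCons_left)
  have le: "c \<le> \<rho>" if "c \<in> set cs" for c
    using nonneg member_le_sum_list[OF that] unfolding trace[symmetric] by auto
  have \<rho>: "0 \<le> \<rho>"
    using nonneg unfolding trace[symmetric] by (auto intro: sum_list_nonneg)
  show "spectral_radius (complexify A) = \<rho>"
    unfolding spectral_radius_def spectrum_of_linear_factors[OF cA cp']
    by (rule Max_eqI) (use \<rho> le nonneg in \<open>auto simp: as_def\<close>)
  have "(\<Sum>c\<leftarrow>cs. \<bar>c\<bar>) = sum_list cs"
    using nonneg by (induction cs) auto
  then show "matrix_energy (complexify A) = 2 * \<rho>"
    unfolding matrix_energy_of_linear_factors[OF cA cp'] using \<rho> trace by (simp add: as_def o_def)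
qed

text \<open>
  The bound on \<open>\<rho>\<close> is what makes the second root of the quadratic factor, which is
  \<open>p * s + q * r - \<rho>\<close> by the sum of the roots, nonpositive.
\<close>

lemma two_block_mat_spectral_radius_energy:
  fixes s t r \<rho> :: real
  assumes T: "T \<subseteq> {..<n}" and q: "card T = Suc q" and n: "n = Suc p + Suc q"
    and sr: "0 \<le> s" "0 \<le> r" and le: "real p * s + real q * r \<le> \<rho>"
    and root: "(\<rho> - real p * s) * (\<rho> - real q * r) = real (Suc p) * real (Suc q) * t\<^sup>2"
  shows "spectral_radius (complexify (two_block_mat n T s t r)) = \<rho>"
    and "matrix_energy (complexify (two_block_mat n T s t r)) = 2 * \<rho>"
proof -
  define \<sigma> where "\<sigma> = \<rho> - real p * s - real q * r"
  define cs where "cs = replicate p s @ replicate q r @ [\<sigma>]"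
  have "[:- (real p * s), 1:] * [:- (real q * r), 1:] - [:real (Suc p) * real (Suc q) * t\<^sup>2:] =
      [:- \<rho>, 1:] * [:\<sigma>, 1:]"
    unfolding root[symmetric] \<sigma>_def by (simp add: algebra_simps)
  then have cp: "char_poly (two_block_mat n T s t r) = [:- \<rho>, 1:] * (\<Prod>c\<leftarrow>cs. [:c, 1:])"
    unfolding char_poly_two_block_mat[OF T q n] cs_def
    by (simp only: map_append map_replicate prod_list.append prod_list_replicate list.map
        prod_list.Cons prod_list.Nil mult_1_right) (simp only: mult_ac)
  have nonneg: "\<forall>c\<in>set cs. 0 \<le> c" and trace: "sum_list cs = \<rho>"
    using sr le by (auto simp: cs_def \<sigma>_def sum_list_replicate)
  have A: "two_block_mat n T s t r \<in> carrier_mat n n" by (simp add: two_block_mat_def)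
  show "spectral_radius (complexify (two_block_mat n T s t r)) = \<rho>"
    and "matrix_energy (complexify (two_block_mat n T s t r)) = 2 * \<rho>"
    by (fact spectral_radius_energy_of_single_positive_eigenvalue[OF A cp nonneg trace])+
qed

section \<open>The weighted matrices of $K_n$ and $K_n - e$\<close>

lemma pair_in_complete_edges: "{i, j} \<in> complete_edges n \<longleftrightarrow> i < n \<and> j < n \<and> i \<noteq> j"
  by (auto simp: complete_edges_def card_2_iff doubleton_eq_iff)

lemma degree_of_complete_edges:
  assumes "v < n" shows "degree_of (complete_edges n) v = n - 1"
proof -
  have "{e \<in> complete_edges n. v \<in> e} = (\<lambda>w. {v, w}) ` ({..<n} - {v})"
    using assms by (auto simp: complete_edges_def card_2_iff)
  moreover have "inj_on (\<lambda>w. {v, w}) ({..<n} - {v})"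
    by (auto simp: inj_on_def doubleton_eq_iff)
  ultimately show ?thesis
    using assms by (simp add: degree_of_def card_image)
qed

lemma degree_of_delete_edge:
  assumes "finite E" and "e \<in> E"
  shows "degree_of (delete_edge E e) v = degree_of E v - (if v \<in> e then 1 else 0)"
proof -
  have "{f \<in> E - {e}. v \<in> f} = {f \<in> E. v \<in> f} - (if v \<in> e then {e} else {})"
    by auto
  then show ?thesis
    using assms by (simp add: degree_of_def delete_edge_def)
qed

lemma finite_complete_edges: "finite (complete_edges n)"
  unfolding complete_edges_def by (rule finite_subset[of _ "Pow {..<n}"]) auto

text \<open>
  All blocks are equal, so \<open>T\<close> is arbitrary; taking \<open>T = e\<close> treats $K_n$ and $K_n - e$ alike.
\<close>

lemma weighted_adjacency_complete:
  "weighted_adjacency (phi \<alpha>) n (complete_edges n) =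
    two_block_mat n T (phi \<alpha> (n - 1) (n - 1)) (phi \<alpha> (n - 1) (n - 1)) (phi \<alpha> (n - 1) (n - 1))"
  by (rule eq_matI)
    (auto simp: weighted_adjacency_def two_block_mat_def pair_in_complete_edges degree_of_complete_edges)

lemma weighted_adjacency_complete_delete_edge:
  assumes e: "e \<in> complete_edges n"
  shows "weighted_adjacency (phi \<alpha>) n (delete_edge (complete_edges n) e) =
    two_block_mat n e (phi \<alpha> (n - 1) (n - 1)) (phi \<alpha> (n - 1) (n - 2)) 0"
proof -
  have edge: "{i, j} = e \<longleftrightarrow> i \<in> e \<and> j \<in> e" if "i \<noteq> j" for i j
    using e that by (auto simp: complete_edges_def card_2_iff)
  have mem: "{i, j} \<in> delete_edge (complete_edges n) e \<longleftrightarrow> i < n \<and> j < n \<and> i \<noteq> j \<and> \<not> (i \<in> e \<and> j \<in> e)"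
    for i j
    using pair_in_complete_edges[of j j n]
    by (cases "i = j") (simp_all add: delete_edge_def pair_in_complete_edges edge)
  have deg: "degree_of (delete_edge (complete_edges n) e) v = (if v \<in> e then n - 2 else n - 1)"
    if "v < n" for v
    using that e by (simp add: degree_of_delete_edge finite_complete_edges degree_of_complete_edges numeral_2_eq_2)
  show ?thesis
    by (rule eq_matI)
      (auto simp: weighted_adjacency_def two_block_mat_def deg mem phi_commute)
qed

section \<open>Comparison\<close>

lemma mult_shifted_less_iff:
  fixes c x y :: real
  assumes "c \<le> x" "c < y" "0 \<le> x"
  shows "x * (x - c) < y * (y - c) \<longleftrightarrow> x < y"
proof -
  have "y * (y - c) - x * (x - c) = (y - x) * (x + (y - c))"
    by (simp add: algebra_simps)
  moreover have "0 < x + (y - c)" using assms by simp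
  ultimately show ?thesis
    by (metis diff_gt_0_iff_gt zero_less_mult_pos2 mult_pos_pos)
qed

theorem corollary3p5:
  fixes \<alpha> :: real and n :: nat and e :: "nat set"
  assumes "n \<ge> 3" and "e \<in> complete_edges n"
  shows
    "(\<alpha> < - 1 / 2 \<longrightarrow>
        weighted_spectral_radius (phi \<alpha>) n (delete_edge (complete_edges n) e)
          > weighted_spectral_radius (phi \<alpha>) n (complete_edges n) \<and>
        weighted_energy (phi \<alpha>) n (delete_edge (complete_edges n) e)
          > weighted_energy (phi \<alpha>) n (complete_edges n)) \<and>
     (\<alpha> = - 1 / 2 \<longrightarrow>
        weighted_spectral_radius (phi \<alpha>) n (delete_edge (complete_edges n) e)
          = weighted_spectral_radius (phi \<alpha>) n (complete_edges n) \<and>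
        weighted_energy (phi \<alpha>) n (delete_edge (complete_edges n) e)
          = weighted_energy (phi \<alpha>) n (complete_edges n)) \<and>
     (\<alpha> > - 1 / 2 \<longrightarrow>
        weighted_spectral_radius (phi \<alpha>) n (delete_edge (complete_edges n) e)
          < weighted_spectral_radius (phi \<alpha>) n (complete_edges n) \<and>
        weighted_energy (phi \<alpha>) n (delete_edge (complete_edges n) e)
          < weighted_energy (phi \<alpha>) n (complete_edges n))"
proof -
  let ?K = "complete_edges n" and ?K' = "delete_edge (complete_edges n) e"
  define p where "p = n - 3"
  have n: "n = Suc p + Suc 1" using assms(1) by (simp add: p_def)
  define M where "M = real (n - 1)"
  define m where "m = real (n - 2)"
  have m: "m = real p + 1" "M = real p + 2" "0 < m" "m < M" "0 < M"
    using n by (auto simp: m_def M_def)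
  define a where "a = phi \<alpha> M M"
  define b where "b = phi \<alpha> M m"
  have a: "0 < a" "a = M powr (2 * \<alpha>)"
    using m by (auto simp: a_def phi_def powr_mult powr_add[symmetric])
  have b: "b\<^sup>2 = a * m powr (2 * \<alpha>)"
    using m a by (auto simp: b_def phi_def powr_mult power2_eq_square powr_add[symmetric] mult_ac)
  have T: "e \<subseteq> {..<n}" "card e = Suc 1"
    using assms(2) by (auto simp: complete_edges_def)
  define R where "R = M * a"
  have K: "weighted_spectral_radius (phi \<alpha>) n ?K = R" "weighted_energy (phi \<alpha>) n ?K = 2 * R"
    unfolding weighted_spectral_radius_def weighted_energy_def weighted_adjacency_complete[of _ _ e]
      M_def[symmetric] a_def[symmetric]
    by (rule two_block_mat_spectral_radius_energy[OF T n]; 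
        use a m in \<open>simp add: R_def algebra_simps power2_eq_square\<close>)+
  define c where "c = real p * a"
  \<comment> \<open>The larger root of $y (y - c) = 2 m b^2$.\<close>
  define \<rho> where "\<rho> = (c + sqrt (c\<^sup>2 + 8 * m * b\<^sup>2)) / 2"
  have c: "0 \<le> c" "c < R" "0 < R" using a m by (auto simp: c_def R_def)
  have disc: "(sqrt (c\<^sup>2 + 8 * m * b\<^sup>2))\<^sup>2 = c\<^sup>2 + 8 * m * b\<^sup>2"
    using m by simp
  have root: "\<rho> * (\<rho> - c) = 2 * m * b\<^sup>2"
  proof -
    have "4 * (\<rho> * (\<rho> - c)) = (sqrt (c\<^sup>2 + 8 * m * b\<^sup>2))\<^sup>2 - c\<^sup>2"
      by (simp add: \<rho>_def field_simps power2_eq_square del: real_sqrt_mult_self)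
    then show ?thesis unfolding disc by simp
  qed
  have le: "c \<le> \<rho>"
  proof -
    have "c \<le> sqrt (c\<^sup>2 + 8 * m * b\<^sup>2)"
      using m by (intro real_le_rsqrt) simp
    then show ?thesis by (simp add: \<rho>_def)
  qed
  have K': "weighted_spectral_radius (phi \<alpha>) n ?K' = \<rho>" "weighted_energy (phi \<alpha>) n ?K' = 2 * \<rho>"
    unfolding weighted_spectral_radius_def weighted_energy_def
      weighted_adjacency_complete_delete_edge[OF assms(2)]
      M_def[symmetric] m_def[symmetric] a_def[symmetric] b_def[symmetric]
    by (rule two_block_mat_spectral_radius_energy[OF T n];
        use a m le root in \<open>simp add: c_def algebra_simps\<close>)+
  have R: "R * (R - c) = 2 * a * M powr (2 * \<alpha> + 1)"
    using m by (simp add: R_def c_def powr_add a(2) algebra_simps)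
  have \<rho>: "\<rho> * (\<rho> - c) = 2 * a * m powr (2 * \<alpha> + 1)"
    using m by (simp add: root b powr_add)
  have less: "\<rho> < R \<longleftrightarrow> m powr (2 * \<alpha> + 1) < M powr (2 * \<alpha> + 1)"
    using mult_shifted_less_iff[of c \<rho> R] le c a(1) unfolding R \<rho> by auto
  \<comment> \<open>Monotonicity needs \<open>c < \<rho>\<close> here; this is automatic because $\rho (\rho - c)$ is positive.\<close>
  have greater: "R < \<rho> \<longleftrightarrow> M powr (2 * \<alpha> + 1) < m powr (2 * \<alpha> + 1)"
  proof (cases "c < \<rho>")
    case True
    then show ?thesis
      using mult_shifted_less_iff[of c R \<rho>] c a(1) unfolding R \<rho> by auto
  next
    case False
    then show ?thesis using le \<rho> a(1) m by simp
  qed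
  show ?thesis
  proof (intro conjI impI; unfold K K')
  qed (use less greater m in \<open>auto intro: powr_less_mono2 powr_less_mono2_neg\<close>)
qed

end
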